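(* Let $q$ be an odd prime and $n$ a positive integer. If $A\subseteq \mathbb{F}_q^n$ contains no triangle with all right angles, i.e. there are no distinct vectors $x,y,z\in A$ with $$\langle x-y,y-z\rangle = \langle y-z, z-x \rangle = \langle z-x, x-y \rangle =0,$$ then $$|A|\le \binom{n+2q-1}{2q-2}+2\binom{n+q}{q-1}.$$
   Context: $\langle u,v\rangle=\sum_{i=1}^n u_iv_i$ denotes the standard dot product on $\mathbb{F}_q^n$. *)

theory Defs
  imports "Jordan_Normal_Form.Matrix" "HOL-Computational_Algebra.Primes" "HOL-Library.Cardinality"
begin

end

theory Submission
  imports Defs "HOL-Number_Theory.Residues"
begin

text \<open>
  For odd \<open>q\<close>, three vectors form a triangle with all right angles iff the three differences are
  isotropic, so the claim concerns sets whose isotropy graph is triangle-free. By Fermat,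
  \<open>f x y = 1 - (|x - y|^2)^(q - 1)\<close> is the indicator of isotropy, and \<open>|x - y|^2\<close> is, for fixed \<open>y\<close>,
  an affine function of the \<open>n + 1\<close> quantities \<open>x\<^sub>1, \<dots>, x\<^sub>n, |x|^2\<close>.

  Linear algebra yields a weight \<open>v\<close> on \<open>A\<close> that annihilates all monomials of degree at most
  \<open>2q - 2\<close> in these quantities and equals \<open>1\<close> outside a set \<open>T\<close> with at most as many elements as
  there are such monomials. If \<open>y\<close> and \<open>z\<close> outside \<open>T\<close> were adjacent, then triangle-freeness would
  reduce \<open>\<Sum>x. v x * f x y * f x z = 0\<close> to \<open>v y + v z = 2 = 0\<close>. Hence \<open>A - T\<close> is
  independent; there \<open>f\<close> is the identity matrix, which bounds its size by the number of monomials of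
  degree at most \<open>q - 1\<close>.
\<close>

section \<open>Finite fields of odd order\<close>

lemma power_card_minus_one_eq_one:
  fixes a :: "'a :: {field, finite}"
  assumes "a \<noteq> 0"
  shows "a ^ (CARD('a) - 1) = 1"
proof -
  let ?U = "UNIV - {0 :: 'a}"
  \<comment> \<open>Multiplication by \<open>a\<close> permutes the nonzero elements, so their
    product can be cancelled below.\<close>
  have "bij_betw ((*) a) ?U ?U"
    by (rule bij_betwI[where g = "\<lambda>x. x / a"]) (use assms in auto)
  then have "\<Prod>?U = (\<Prod>x\<in>?U. a * x)"
    by (rule prod.reindex_bij_betw[symmetric])
  also have "\<dots> = a ^ (CARD('a) - 1) * \<Prod>?U"
    by (simp add: prod.distrib card_Diff_singleton)
  finally show ?thesis
    by simp
qed

lemma two_neq_zero_if_odd_card: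
  assumes "odd CARD('a :: {field, finite})"
  shows "(2 :: 'a) \<noteq> 0"
proof
  assume "(2 :: 'a) = 0"
  then have "of_nat 2 = (0 :: 'a)"
    by simp
  then have "CHAR('a) dvd 2"
    by (simp only: of_nat_eq_0_iff_char_dvd)
  then have "CHAR('a) = 2"
    using two_is_prime_nat CHAR_not_1[where 'a = 'a] by (auto simp: prime_nat_iff)
  then show False
    using CHAR_dvd_CARD[where 'a = 'a] assms by simp
qed

section \<open>Weights orthogonal to finitely many functions\<close>

lemma ex_annihilating_basis:
  fixes g :: "'i \<Rightarrow> 'b \<Rightarrow> 'a :: field"
  assumes "finite A" and "finite I"
  shows "\<exists>T e. T \<subseteq> A \<and> card T \<le> card I \<and>
    (\<forall>t\<in>A - T. (\<forall>s\<in>A - T. e t s = (if s = t then 1 else 0)) \<and>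
      (\<forall>i\<in>I. (\<Sum>s\<in>A. e t s * g i s) = 0))"
  using assms(2)
proof (induction I)
  case empty
  show ?case
    by (intro exI[of _ "{}"] exI[of _ "\<lambda>t s. if s = t then 1 else 0"]) auto
next
  case (insert j I)
  then obtain T e where T: "T \<subseteq> A" "card T \<le> card I"
    and e: "\<And>t s. t \<in> A - T \<Longrightarrow> s \<in> A - T \<Longrightarrow> e t s = (if s = t then 1 else 0)"
    and orth: "\<And>t i. t \<in> A - T \<Longrightarrow> i \<in> I \<Longrightarrow> (\<Sum>s\<in>A. e t s * g i s) = 0"
    by blast
  let ?p = "\<lambda>t i. \<Sum>s\<in>A. e t s * g i s"
  show ?case
  proof (cases "\<exists>t0\<in>A - T. ?p t0 j \<noteq> 0")
    case False
    then show ?thesis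
      using T e orth insert.hyps by (intro exI[of _ T] exI[of _ e]) auto
  next
    case True
    then obtain t0 where t0: "t0 \<in> A - T" "?p t0 j \<noteq> 0"
      by blast
    \<comment> \<open>Elimination with pivot \<open>t0\<close>: the correction makes constraint
      \<open>j\<close> hold and preserves the earlier ones. As \<open>t0\<close> moves into
      \<open>T\<close> and \<open>e t0\<close> is zero at the other points of \<open>A - T\<close>,
      the identity pattern survives, at the cost of one point per constraint.\<close>
    define e' where "e' t s = e t s - ?p t j / ?p t0 j * e t0 s" for t s
    have "(\<Sum>s\<in>A. e' t s * g i s) = ?p t i - ?p t j / ?p t0 j * ?p t0 i" for t i
      unfolding e'_def
      by (simp only: left_diff_distrib sum_subtractf sum_distrib_left mult.assoc)
    moreover have "finite T"
      using T(1) assms(1) finite_subset by blast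
    ultimately show ?thesis
      using T e orth insert.hyps t0
      by (intro exI[of _ "insert t0 T"] exI[of _ e']) (auto simp: e'_def card_insert_if)
  qed
qed

text \<open>Sum all basis vectors: at a point outside \<open>T\<close> exactly one of them
  contributes, with value 1.\<close>

lemma ex_annihilating_weight:
  fixes g :: "'i \<Rightarrow> 'b \<Rightarrow> 'a :: field"
  assumes "finite A" and "finite I"
  obtains T v where "T \<subseteq> A" and "card T \<le> card I" and "\<And>s. s \<in> A - T \<Longrightarrow> v s = 1"
    and "\<And>i. i \<in> I \<Longrightarrow> (\<Sum>s\<in>A. v s * g i s) = 0"
proof -
  obtain T e where T: "T \<subseteq> A" "card T \<le> card I"
    and e: "\<And>t s. t \<in> A - T \<Longrightarrow> s \<in> A - T \<Longrightarrow> e t s = (if s = t then 1 else 0)"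
    and orth: "\<And>t i. t \<in> A - T \<Longrightarrow> i \<in> I \<Longrightarrow> (\<Sum>s\<in>A. e t s * g i s) = 0"
    using ex_annihilating_basis[OF assms, of g] by blast
  define v where "v s = (\<Sum>t\<in>A - T. e t s)" for s
  have "v s = 1" if "s \<in> A - T" for s
  proof -
    have "v s = (\<Sum>t\<in>A - T. if s = t then 1 else 0)"
      unfolding v_def using that e by (intro sum.cong) auto
    then show ?thesis
      using that assms(1) by simp
  qed
  moreover have "(\<Sum>s\<in>A. v s * g i s) = 0" if "i \<in> I" for i
  proof -
    have "(\<Sum>s\<in>A. v s * g i s) = (\<Sum>t\<in>A - T. \<Sum>s\<in>A. e t s * g i s)"
      unfolding v_def sum_distrib_right by (rule sum.swap)
    then show ?thesis
      using orth that by simp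
  qed
  ultimately show ?thesis
    using T that by blast
qed

section \<open>Monomials and products of linear forms\<close>

definition lincomb :: "nat \<Rightarrow> (nat \<Rightarrow> 'b \<Rightarrow> 'a) \<Rightarrow> (nat \<Rightarrow> 'a) \<Rightarrow> 'b \<Rightarrow> 'a :: comm_semiring_1"
  where "lincomb m \<phi> c x = (\<Sum>i<m. c i * \<phi> i x)"

text \<open>Exponents form a list, so that monomials of a given degree are counted as lists of given
  length and sum.\<close>

definition monomial :: "nat \<Rightarrow> (nat \<Rightarrow> 'b \<Rightarrow> 'a) \<Rightarrow> nat list \<Rightarrow> 'b \<Rightarrow> 'a :: comm_semiring_1"
  where "monomial m \<phi> l x = (\<Prod>i<m. \<phi> i x ^ (l ! i))"

lemma monomial_incr:
  assumes "i < m" and "length l = m"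
  shows "monomial m \<phi> (l[i := Suc (l ! i)]) x = monomial m \<phi> l x * \<phi> i x"
proof -
  have "monomial m \<phi> (l[i := Suc (l ! i)]) x =
      \<phi> i x ^ Suc (l ! i) * (\<Prod>k\<in>{..<m} - {i}. \<phi> k x ^ (l ! k))"
    unfolding monomial_def using assms by (subst prod.remove[of _ i]) (auto intro!: prod.cong)
  moreover have "monomial m \<phi> l x = \<phi> i x ^ (l ! i) * (\<Prod>k\<in>{..<m} - {i}. \<phi> k x ^ (l ! k))"
    unfolding monomial_def using assms by (subst prod.remove[of _ i]) auto
  ultimately show ?thesis
    by (simp add: mult_ac)
qed

lemma sum_list_incr:
  fixes l :: "nat list"
  assumes "i < length l"
  shows "sum_list (l[i := Suc (l ! i)]) = Suc (sum_list l)"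
  using assms elem_le_sum_list[of i l] by (simp add: sum_list_update)

text \<open>Expand one linear factor at a time. Each choice of a summand raises one exponent of
  \<open>l\<close>, so the total degree stays \<open>d\<close>; the accumulated monomial is what
  lets the induction go through.\<close>

lemma annihilates_lincomb_product:
  fixes v :: "'b \<Rightarrow> 'a :: comm_semiring_1"
  assumes ann: "\<And>l. length l = m \<Longrightarrow> sum_list l = d \<Longrightarrow> (\<Sum>x\<in>A. v x * monomial m \<phi> l x) = 0"
    and "length l = m" and "length cs + sum_list l = d"
  shows "(\<Sum>x\<in>A. v x * (monomial m \<phi> l x * (\<Prod>c\<leftarrow>cs. lincomb m \<phi> c x))) = 0"
  using assms(2,3)
proof (induction cs arbitrary: l)
  case Nil
  then show ?case
    using ann by simp
next
  case (Cons c cs)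
  let ?P = "\<lambda>x. \<Prod>c\<leftarrow>cs. lincomb m \<phi> c x"
  have "(\<Sum>x\<in>A. v x * (monomial m \<phi> l x * (\<Prod>c\<leftarrow>c # cs. lincomb m \<phi> c x))) =
      (\<Sum>x\<in>A. \<Sum>i<m. c i * (v x * (monomial m \<phi> (l[i := Suc (l ! i)]) x * ?P x)))"
  proof (rule sum.cong[OF refl])
    fix x
    have "v x * (monomial m \<phi> l x * (\<Prod>c\<leftarrow>c # cs. lincomb m \<phi> c x)) =
        (v x * monomial m \<phi> l x * ?P x) * lincomb m \<phi> c x"
      by (simp add: mult_ac)
    also have "\<dots> = (\<Sum>i<m. c i * (v x * (monomial m \<phi> (l[i := Suc (l ! i)]) x * ?P x)))"
      unfolding lincomb_def[of m \<phi> c] sum_distrib_left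
      by (intro sum.cong refl) (simp add: monomial_incr Cons.prems mult_ac)
    finally show "v x * (monomial m \<phi> l x * (\<Prod>c\<leftarrow>c # cs. lincomb m \<phi> c x)) = \<dots>" .
  qed
  also have "\<dots> = (\<Sum>i<m. c i * (\<Sum>x\<in>A. v x * (monomial m \<phi> (l[i := Suc (l ! i)]) x * ?P x)))"
    unfolding sum_distrib_left by (rule sum.swap)
  also have "\<dots> = 0"
    using Cons.prems by (intro sum.neutral ballI) (subst Cons.IH, auto simp: sum_list_incr)
  finally show ?case .
qed

section \<open>Squared distances as linear forms\<close>

definition coord :: "nat \<Rightarrow> nat \<Rightarrow> 'a :: comm_ring_1 vec \<Rightarrow> 'a"
  where "coord n i x = (if i < n then x $ i else if i = n then x \<bullet> x else 1)"

text \<open>These are the coefficients of |x|^2 - 2<x,y> + |y|^2, read as a form in the coordinates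
  of x, |x|^2 and 1.\<close>

definition dist_coeff :: "nat \<Rightarrow> 'a :: comm_ring_1 vec \<Rightarrow> nat \<Rightarrow> 'a"
  where "dist_coeff n y i = (if i < n then - 2 * y $ i else if i = n then 1 else y \<bullet> y)"

lemma scalar_prod_diff_self:
  fixes x y :: "'a :: comm_ring_1 vec"
  assumes "x \<in> carrier_vec n" and "y \<in> carrier_vec n"
  shows "(x - y) \<bullet> (x - y) = x \<bullet> x - 2 * (x \<bullet> y) + y \<bullet> y"
  using assms comm_scalar_prod[of y n x]
  by (simp add: minus_scalar_prod_distrib[of _ n] scalar_prod_minus_distrib[of _ n] algebra_simps)

lemma lincomb_dist_coeff:
  fixes x y :: "'a :: comm_ring_1 vec"
  assumes "x \<in> carrier_vec n" and "y \<in> carrier_vec n"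
  shows "lincomb (n + 2) (coord n) (dist_coeff n y) x = (x - y) \<bullet> (x - y)"
proof -
  have "(\<Sum>i<n. dist_coeff n y i * coord n i x) = - 2 * (x \<bullet> y)"
    using assms unfolding scalar_prod_def sum_distrib_left
    by (intro sum.cong) (auto simp: coord_def dist_coeff_def)
  then show ?thesis
    by (simp add: lincomb_def scalar_prod_diff_self[OF assms])
      (simp add: coord_def dist_coeff_def)
qed

text \<open>The constant coordinate homogenises: padding with this form turns degree at most
  \<open>d\<close> into degree exactly \<open>d\<close>.\<close>

lemma lincomb_one: "lincomb (n + 2) (coord n) (\<lambda>i. if i = n + 1 then 1 else 0) x = 1"
  by (simp add: lincomb_def coord_def)

lemma ex_weight_annihilating_dist_powers:
  fixes A :: "'a :: field vec set"
  assumes "finite A" and "A \<subseteq> carrier_vec n"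
  shows "\<exists>T v. T \<subseteq> A \<and> card T \<le> (n + d + 1) choose d \<and> (\<forall>s\<in>A - T. v s = 1) \<and>
    (\<forall>y\<in>carrier_vec n. \<forall>z\<in>carrier_vec n. \<forall>j k. j + k \<le> d \<longrightarrow>
      (\<Sum>x\<in>A. v x * (((x - y) \<bullet> (x - y)) ^ j * ((x - z) \<bullet> (x - z)) ^ k)) = 0)"
proof -
  define I where "I = {l :: nat list. length l = n + 2 \<and> sum_list l = d}"
  have card_I: "card I = (n + d + 1) choose d"
    by (simp add: I_def card_length_sum_list add_ac)
  \<comment> \<open>An infinite set has \<open>card\<close> 0, so a positive cardinality yields
    finiteness.\<close>
  moreover have "0 < (n + d + 1) choose d"
    by simp
  ultimately have "finite I"
    using card_gt_0_iff by metis
  from ex_annihilating_weight[OF assms(1) this, of "monomial (n + 2) (coord n)"]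
  obtain T v where T: "T \<subseteq> A" "card T \<le> card I" and v: "\<And>s. s \<in> A - T \<Longrightarrow> v s = 1"
    and orth: "\<And>l. l \<in> I \<Longrightarrow> (\<Sum>s\<in>A. v s * monomial (n + 2) (coord n) l s) = 0"
    by blast
  have "(\<Sum>x\<in>A. v x * (((x - y) \<bullet> (x - y)) ^ j * ((x - z) \<bullet> (x - z)) ^ k)) = 0"
    if yz: "y \<in> carrier_vec n" "z \<in> carrier_vec n" and "j + k \<le> d" for j k y z
  proof -
    \<comment> \<open>Exactly \<open>d\<close> linear factors, the last \<open>d - (j + k)\<close>
      of them equal to 1. The expansion starts from the zero exponent list, whose monomial is
      1.\<close>
    define cs where "cs = replicate j (dist_coeff n y) @ replicate k (dist_coeff n z) @
      replicate (d - (j + k)) (\<lambda>i. if i = n + 1 then 1 else 0)"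
    have "(\<Prod>c\<leftarrow>cs. lincomb (n + 2) (coord n) c x) =
        ((x - y) \<bullet> (x - y)) ^ j * ((x - z) \<bullet> (x - z)) ^ k" if "x \<in> A" for x
    proof -
      have "x \<in> carrier_vec n"
        using that assms(2) by blast
      then show ?thesis
        unfolding cs_def by (simp only: map_append map_replicate prod_list.append prod_list_replicate
            lincomb_dist_coeff lincomb_one yz power_one mult_1_right)
    qed
    moreover have "monomial (n + 2) (coord n) (replicate (n + 2) 0) x = 1" for x :: "'a vec"
      unfolding monomial_def by (intro prod.neutral) (simp del: replicate.simps)
    moreover have "(\<Sum>x\<in>A. v x * (monomial (n + 2) (coord n) (replicate (n + 2) 0) x *
        (\<Prod>c\<leftarrow>cs. lincomb (n + 2) (coord n) c x))) = 0"
      using \<open>j + k \<le> d\<close> orth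
      by (intro annihilates_lincomb_product[where d = d]) (auto simp: I_def cs_def sum_list_replicate)
    ultimately show ?thesis
      by simp
  qed
  with T v card_I show ?thesis
    by (intro exI[of _ T] exI[of _ v]) simp
qed

section \<open>Isotropic triangles and the bound\<close>

lemma right_angles_if_isotropic:
  fixes x y z :: "'a :: field vec"
  assumes "(2 :: 'a) \<noteq> 0"
    and "x \<in> carrier_vec n" "y \<in> carrier_vec n" "z \<in> carrier_vec n"
    and "(x - y) \<bullet> (x - y) = 0" "(y - z) \<bullet> (y - z) = 0" "(x - z) \<bullet> (x - z) = 0"
  shows "(x - y) \<bullet> (y - z) = 0"
proof -
  \<comment> \<open>Polarisation, since x - z = (x - y) + (y - z).\<close>
  have "2 * ((x - y) \<bullet> (y - z)) =
      (x - z) \<bullet> (x - z) - (x - y) \<bullet> (x - y) - (y - z) \<bullet> (y - z)"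
    using assms(2-4) comm_scalar_prod[of y n x] comm_scalar_prod[of z n x] comm_scalar_prod[of z n y]
    by (simp add: minus_scalar_prod_distrib[of _ n] scalar_prod_minus_distrib[of _ n] algebra_simps)
  then show ?thesis
    using assms by simp
qed

lemma isotropic_sym:
  fixes x y :: "'a :: comm_ring_1 vec"
  assumes "x \<in> carrier_vec n" and "y \<in> carrier_vec n"
  shows "(x - y) \<bullet> (x - y) = (y - x) \<bullet> (y - x)"
  using assms comm_scalar_prod[of y n x] by (simp add: scalar_prod_diff_self algebra_simps)

theorem theorem1p5:
  fixes q n :: nat and A :: "'a::{field,finite} vec set"
  assumes "prime q" and "odd q" and "CARD('a) = q" and "n > 0"
    and "A \<subseteq> carrier_vec n"
    and "\<not> (\<exists>x\<in>A. \<exists>y\<in>A. \<exists>z\<in>A. x \<noteq> y \<and> y \<noteq> z \<and> z \<noteq> x \<and>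
           (x - y) \<bullet> (y - z) = 0 \<and> (y - z) \<bullet> (z - x) = 0 \<and> (z - x) \<bullet> (x - y) = 0)"
  shows "card A \<le> ((n + 2*q - 1) choose (2*q - 2)) + 2 * ((n + q) choose (q - 1))"
proof (cases "finite A")
  case True
  have two: "(2 :: 'a) \<noteq> 0"
    using two_neq_zero_if_odd_card assms by blast
  have q: "q \<ge> 2"
    using assms(1) by (rule prime_ge_2_nat)
  have carrier: "x \<in> carrier_vec n" if "x \<in> A" for x
    using that assms(5) by blast
  define N :: "'a vec \<Rightarrow> 'a vec \<Rightarrow> 'a" where "N x y = (x - y) \<bullet> (x - y)" for x y
  have N_sym: "N x y = N y x" if "x \<in> A" "y \<in> A" for x y
    unfolding N_def using that carrier by (intro isotropic_sym) auto
  have N_refl: "N x x = 0" if "x \<in> A" for x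
    unfolding N_def using carrier[OF that] by simp
  have triangle_free: False
    if "x \<in> A" "y \<in> A" "z \<in> A" "x \<noteq> y" "y \<noteq> z" "z \<noteq> x" "N x y = 0" "N y z = 0" "N z x = 0" for x y z
  proof -
    have "(x - y) \<bullet> (y - z) = 0" "(y - z) \<bullet> (z - x) = 0" "(z - x) \<bullet> (x - y) = 0"
      by (rule right_angles_if_isotropic[OF two]; use that carrier N_sym in \<open>auto simp: N_def\<close>)+
    then show False
      using assms(6) that by blast
  qed
  have indicator: "1 - N x y ^ (q - 1) = (if N x y = 0 then 1 else 0)" for x y
    using q power_card_minus_one_eq_one[of "N x y"] assms(3) by auto
  \<comment> \<open>A product of two isotropy indicators has degree 2(q - 1) in the
    coordinates.\<close>
  obtain T v where T: "T \<subseteq> A" "card T \<le> (n + (2 * q - 2) + 1) choose (2 * q - 2)"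
    and v: "\<forall>s\<in>A - T. v s = 1"
    and orth: "\<forall>y\<in>carrier_vec n. \<forall>z\<in>carrier_vec n. \<forall>j k. j + k \<le> 2 * q - 2 \<longrightarrow>
      (\<Sum>x\<in>A. v x * (N x y ^ j * N x z ^ k)) = 0"
    unfolding N_def using ex_weight_annihilating_dist_powers[OF True assms(5), of "2 * q - 2"] by blast
  have independent: "N y z \<noteq> 0" if y: "y \<in> A - T" and z: "z \<in> A - T" and "y \<noteq> z" for y z
  proof
    assume "N y z = 0"
    have *: "(\<Sum>x\<in>A. v x * (N x y ^ j * N x z ^ k)) = 0" if "j + k \<le> 2 * q - 2" for j k
      using orth that y z carrier by blast
    let ?r = "q - 1"
    have "(\<Sum>x\<in>A. v x * ((1 - N x y ^ ?r) * (1 - N x z ^ ?r))) =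
        (\<Sum>x\<in>A. v x * (N x y ^ 0 * N x z ^ 0)) - (\<Sum>x\<in>A. v x * (N x y ^ ?r * N x z ^ 0))
        - (\<Sum>x\<in>A. v x * (N x y ^ 0 * N x z ^ ?r)) + (\<Sum>x\<in>A. v x * (N x y ^ ?r * N x z ^ ?r))"
      unfolding sum_subtractf[symmetric] sum.distrib[symmetric]
      by (intro sum.cong refl) (simp add: algebra_simps)
    also have "\<dots> = 0"
      using q by (subst *, simp)+ simp
    finally have "0 = (\<Sum>x\<in>A. v x * ((1 - N x y ^ ?r) * (1 - N x z ^ ?r)))" ..
    \<comment> \<open>Any other x with a nonzero term would be isotropic to both y and z, completing
      a forbidden triangle.\<close>
    also have "\<dots> = (\<Sum>x\<in>{y, z}. v x * ((1 - N x y ^ ?r) * (1 - N x z ^ ?r)))"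
    proof (rule sum.mono_neutral_right)
      have "N x y \<noteq> 0 \<or> N x z \<noteq> 0" if "x \<in> A - {y, z}" for x
        using triangle_free[of x y z] N_sym[of x z] that y z \<open>N y z = 0\<close> \<open>y \<noteq> z\<close> by auto
      then show "\<forall>x\<in>A - {y, z}. v x * ((1 - N x y ^ ?r) * (1 - N x z ^ ?r)) = 0"
        unfolding indicator by auto
    qed (use True y z in auto)
    also have "\<dots> = 2"
      unfolding indicator using y z \<open>y \<noteq> z\<close> \<open>N y z = 0\<close> N_sym[of y z] v by (simp add: N_refl)
    finally show False
      using two by simp
  qed
  define S where "S = A - T"
  have S: "finite S" "S \<subseteq> carrier_vec n"
    using True assms(5) by (auto simp: S_def)
  \<comment> \<open>The rank bound in dual form: pairing \<open>w\<close> with row y of the identity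
    matrix gives \<open>w y\<close>, so \<open>w\<close> vanishes on \<open>S\<close>. As it is 1
    off \<open>T'\<close>, the set \<open>T'\<close> exhausts \<open>S\<close>.\<close>
  obtain T' w where T': "T' \<subseteq> S" "card T' \<le> (n + (q - 1) + 1) choose (q - 1)"
    and w: "\<forall>s\<in>S - T'. w s = 1"
    and orth': "\<forall>y\<in>carrier_vec n. \<forall>z\<in>carrier_vec n. \<forall>j k. j + k \<le> q - 1 \<longrightarrow>
      (\<Sum>x\<in>S. w x * (N x y ^ j * N x z ^ k)) = 0"
    unfolding N_def using ex_weight_annihilating_dist_powers[OF S, of "q - 1"] by blast
  have "S \<subseteq> T'"
  proof
    fix y
    assume y: "y \<in> S"
    have "w y = (\<Sum>x\<in>S. w x * (1 - N x y ^ (q - 1)))"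
    proof -
      have "(\<Sum>x\<in>S. w x * (1 - N x y ^ (q - 1))) = (\<Sum>x\<in>S. if x = y then w x else 0)"
        using independent y unfolding indicator by (intro sum.cong) (auto simp: S_def N_refl)
      then show ?thesis
        using S y by simp
    qed
    \<comment> \<open>With a single centre, \<open>y\<close> fills both slots of
      \<open>orth'\<close>, the second with exponent 0.\<close>
    also have "\<dots> = (\<Sum>x\<in>S. w x * (N x y ^ 0 * N x y ^ 0)) - (\<Sum>x\<in>S. w x * (N x y ^ (q - 1) * N x y ^ 0))"
      by (simp add: algebra_simps sum_subtractf)
    also have "\<dots> = 0 - 0"
      using y S by (intro arg_cong2[where f = "(-)"] orth'[rule_format]) auto
    finally show "y \<in> T'"
      using w y by force
  qed
  then have "card S \<le> (n + q) choose (q - 1)"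
    using T' q by (simp add: subset_antisym)
  moreover have "card A = card T + card S"
    using T(1) True by (simp add: S_def card_Diff_subset card_mono finite_subset)
  moreover have "card T \<le> (n + 2 * q - 1) choose (2 * q - 2)"
  proof -
    have "n + (2 * q - 2) + 1 = n + 2 * q - 1"
      using q by simp
    then show ?thesis
      using T(2) by (simp only:)
  qed
  ultimately show ?thesis
    by linarith
\<comment> \<open>In the infinite case \<open>card A\<close> is 0.\<close>
qed simp

end
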